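(* There exists a constant $C(\mathscr L,d,n)>0$ such that for all $\lambda\in\Lambda=[1/2,3/2]$, all $\theta\in\mathbb R$ and all $K>1$, $\Gamma\ge2$, any $\Gamma$-chain of singular sites of $D(\lambda,\theta)$ in $\Sigma_K$ has length $$L\le(K\Gamma)^{C(\mathscr L,d,n)} .$$
   Context: $\mathscr L=\{\sum_{i=1}^d m_i\mathbf v_i: m_i\in\mathbb Z\}$ is an arbitrary lattice of $\mathbb R^d$ with linearly independent generators $\mathbf v_1,\dots,\mathbf v_d$; $\mathbf V=(\mathbf v_1|\cdots|\mathbf v_d)$, $W=\mathbf V^{-\top}$, and $\mu_j=\|Wj\|^2$ for $j\in\mathbb Z^d$ ($\|\cdot\|$ Euclidean). $m$ is a real number, fixed once and for all. For integer vectors $|\cdot|$ is the max norm. The vector $\bar\omega\in\mathbb R^n$ is fixed with $\sum_p|\bar\omega_p|\le1$ and is Diophantine: for some $\gamma_0>0$, $\tau_0\ge n$, $|\bar\omega\cdot\ell|\ge2\gamma_0/|\ell|^{\tau_0}$ for all $\ell\in\mathbb Z^n\setminus\{0\}$. $D(\lambda,\theta)$ is the infinite diagonal matrix with entries $D_{\ell,j,\mathfrak a}(\lambda,\theta)=-\mathfrak a(\lambda\bar\omega\cdot\ell+\theta)+\mu_j+m$, $(\ell,j,\mathfrak a)\in\mathbb Z^n\times\mathbb Z^d\times\{1,-1\}$. A site $(\ell,j,\mathfrak a)$ is singular for $D(\lambda,\theta)$ if $|D_{\ell,j,\mathfrak a}(\lambda,\theta)|<1$. For $\Gamma\ge2$,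 a $\Gamma$-chain is a sequence of distinct integer vectors $(\ell_q,j_q,\mathfrak a_q)_{q=0,\dots,L}\subset\mathbb Z^n\times\mathbb Z^d\times\{1,-1\}$ with $\max\{|\ell_{q+1}-\ell_q|,|j_{q+1}-j_q|,|\mathfrak a_{q+1}-\mathfrak a_q|\}\le\Gamma$ for all $0\le q\le L-1$; $L$ is its length. For $K>1$, $\Sigma_K$ denotes any set of singular sites of $D(\lambda,\theta)$ such that for every $\tilde\jmath\in\mathbb Z^d$ the section $\{(\ell,\tilde\jmath,\mathfrak a)\in\Sigma_K\}$ has at most $K$ elements. *)

theory Defs
  imports "HOL-Analysis.Analysis"
begin

definition max_norm :: "int ^ 'n \<Rightarrow> int" where
  "max_norm x = Max (range (\<lambda>i. \<bar>x $ i\<bar>))"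

definition real_vec :: "int ^ 'n \<Rightarrow> real ^ 'n" where
  "real_vec x = (\<chi> i. real_of_int (x $ i))"

text \<open>The generator \<open>v k\<close> is the \<open>k\<close>-th \<^emph>\<open>column\<close> of the matrix.\<close>

definition generator_matrix :: "('d \<Rightarrow> real ^ 'd) \<Rightarrow> real ^ 'd ^ 'd" where
  "generator_matrix v = (\<chi> i k. v k $ i)"

definition dual_matrix :: "('d \<Rightarrow> real ^ 'd) \<Rightarrow> real ^ 'd ^ 'd" where
  "dual_matrix v = transpose (matrix_inv (generator_matrix v))"

definition \<mu> :: "('d \<Rightarrow> real ^ 'd) \<Rightarrow> int ^ 'd \<Rightarrow> real" where
  "\<mu> v j = (norm (dual_matrix v *v real_vec j))\<^sup>2"

definition diophantine :: "real ^ 'n \<Rightarrow> bool" where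
  "diophantine \<omega> \<longleftrightarrow>
     (\<exists>\<gamma>\<^sub>0 \<tau>\<^sub>0. \<gamma>\<^sub>0 > 0 \<and> \<tau>\<^sub>0 \<ge> real CARD('n) \<and>
        (\<forall>l. l \<noteq> 0 \<longrightarrow>
           \<bar>\<omega> \<bullet> real_vec l\<bar> \<ge> 2 * \<gamma>\<^sub>0 / real_of_int (max_norm l) powr \<tau>\<^sub>0))"

type_synonym ('n, 'd) site = "(int ^ 'n) \<times> (int ^ 'd) \<times> int"

text \<open>The third component of an element of type \<open>site\<close> is any integer; the admissible
  index set is \<open>sites\<close>.\<close>

definition sites :: "('n::finite, 'd::finite) site set" where
  "sites = UNIV \<times> UNIV \<times> {1, -1}"

text \<open>The diagonal matrix \<open>D(lam, \<theta>)\<close> is represented by its family of diagonal entries.\<close>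

definition D_entry ::
  "('d \<Rightarrow> real ^ 'd) \<Rightarrow> real \<Rightarrow> real ^ 'n \<Rightarrow> real \<Rightarrow> real \<Rightarrow> ('n, 'd) site \<Rightarrow> real" where
  "D_entry v m \<omega> lam \<theta> = (\<lambda>(l, j, a).
     - real_of_int a * (lam * (\<omega> \<bullet> real_vec l) + \<theta>) + \<mu> v j + m)"

definition singular_sites ::
  "('d \<Rightarrow> real ^ 'd) \<Rightarrow> real \<Rightarrow> real ^ 'n \<Rightarrow> real \<Rightarrow> real \<Rightarrow> ('n::finite, 'd::finite) site set" where
  "singular_sites v m \<omega> lam \<theta> = {s \<in> sites. \<bar>D_entry v m \<omega> lam \<theta> s\<bar> < 1}"

definition sections_bounded :: "real \<Rightarrow> ('n, 'd) site set \<Rightarrow> bool" where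
  "sections_bounded K S \<longleftrightarrow>
     (\<forall>j'. finite {(l, j, a) \<in> S. j = j'} \<and> real (card {(l, j, a) \<in> S. j = j'}) \<le> K)"

definition site_dist :: "('n::finite, 'd::finite) site \<Rightarrow> ('n, 'd) site \<Rightarrow> int" where
  "site_dist = (\<lambda>(l, j, a) (l', j', a').
     Max {max_norm (l' - l), max_norm (j' - j), \<bar>a' - a\<bar>})"

text \<open>A chain of length \<open>L\<close> consists of the \<open>L + 1\<close> sites \<open>s 0, \<dots>, s L\<close>;
  the values of \<open>s\<close> beyond \<open>L\<close> are irrelevant.\<close>

definition is_chain :: "real \<Rightarrow> nat \<Rightarrow> (nat \<Rightarrow> ('n::finite, 'd::finite) site) \<Rightarrow> bool" where
  "is_chain \<Gamma> L s \<longleftrightarrow>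
     s ` {..L} \<subseteq> sites \<and> inj_on s {..L} \<and>
     (\<forall>q<L. real_of_int (site_dist (s q) (s (Suc q))) \<le> \<Gamma>)"

end

theory Submission imports Defs begin

text \<open>Along sites of one fixed sign, \<open>\<mu>\<close> varies slowly, so the vectors \<open>u q = W j\<^sub>q\<close> form a chain in the
  lattice \<open>W \<int>\<^sup>d\<close> with small steps and slowly varying norm. If every window of length \<open>J\<close> of differences
  spans the same space \<open>G\<close>, then the inner products of \<open>u q\<close> with a short lattice basis of \<open>G\<close> are
  bounded, hence so is the projection of \<open>u q\<close> to \<open>G\<close>, and therefore the diameter of the chain;
  counting lattice points bounds its length. Otherwise some window lies in a smaller subspace, and
  one inducts on the dimension.

  For mixed signs, the constant-sign blocks are short by the above, so the sites with sign \<open>1\<close>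
  form a subchain with moderately enlarged \<open>\<Gamma>\<close>. This gives a constant independent of \<open>m\<close>, with no
  separate discussion of the sites where \<open>\<mu> + m\<close> is small.\<close>

section \<open>Telescoping and fibre counting\<close>

text \<open>Stated for a normed space so that it serves both the vector chain and real quantities
  along it, such as squared norms and phases.\<close>

lemma norm_diff_le_steps:
  fixes f :: "nat \<Rightarrow> 'a::real_normed_vector"
  assumes "\<And>q. q < L \<Longrightarrow> norm (f (Suc q) - f q) \<le> H"
  shows "p + k \<le> L \<Longrightarrow> norm (f (p + k) - f p) \<le> H * real k"
proof (induction k)
  case (Suc k)
  have "norm (f (p + Suc k) - f p) \<le> norm (f (Suc (p + k)) - f (p + k)) + norm (f (p + k) - f p)"
    using norm_triangle_ineq[of "f (Suc (p + k)) - f (p + k)" "f (p + k) - f p"] by simp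
  also have "\<dots> \<le> H + H * real k"
    using Suc assms[of "p + k"] by (intro add_mono) auto
  finally show ?case by (simp add: algebra_simps)
qed simp

lemma real_card_le_by_fibers:
  fixes K :: real
  assumes "finite I" and "f ` I \<subseteq> F" and "finite F" and "K \<ge> 0"
    and "\<And>x. real (card {i \<in> I. f i = x}) \<le> K"
  shows "real (card I) \<le> K * real (card F)"
proof -
  have "card I = card (\<Union>x\<in>F. {i \<in> I. f i = x})"
    using assms(2) by (intro arg_cong[of _ _ card]) auto
  also have "\<dots> \<le> (\<Sum>x\<in>F. card {i \<in> I. f i = x})"
    using assms(3) by (rule card_UN_le)
  finally have "real (card I) \<le> (\<Sum>x\<in>F. real (card {i \<in> I. f i = x}))"
    by (metis of_nat_le_iff of_nat_sum)
  also have "\<dots> \<le> (\<Sum>x\<in>F. K)"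
    using assms(5) by (intro sum_mono)
  finally show ?thesis by (simp add: mult.commute)
qed

section \<open>Discrete subgroups with polynomially many points in balls\<close>

text \<open>The length bound for chains uses nothing of the lattice but closure under differences
  and this counting of points; no basis or determinant is mentioned.\<close>

locale polynomial_growth_lattice =
  fixes \<Lambda> :: "'a::euclidean_space set" and A :: real and D :: nat
  assumes zero_mem: "0 \<in> \<Lambda>"
    and diff_mem: "x \<in> \<Lambda> \<Longrightarrow> y \<in> \<Lambda> \<Longrightarrow> x - y \<in> \<Lambda>"
    and finite_ball: "finite {x \<in> \<Lambda>. norm x \<le> r}"
    and card_ball: "0 \<le> r \<Longrightarrow> real (card {x \<in> \<Lambda>. norm x \<le> r}) \<le> A * (1 + r) ^ D"
begin

lemma add_mem: "x \<in> \<Lambda> \<Longrightarrow> y \<in> \<Lambda> \<Longrightarrow> x + y \<in> \<Lambda>"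
  using diff_mem[of x "0 - y"] diff_mem[of 0 y] zero_mem by simp

lemma scaleR_nat_mem: "x \<in> \<Lambda> \<Longrightarrow> real k *\<^sub>R x \<in> \<Lambda>"
  by (induction k) (auto simp: zero_mem scaleR_left_distrib intro: add_mem)

lemma scaleR_int_mem: "x \<in> \<Lambda> \<Longrightarrow> real_of_int k *\<^sub>R x \<in> \<Lambda>"
  using scaleR_nat_mem[of x "nat k"] diff_mem[OF zero_mem scaleR_nat_mem[of x "nat (- k)"]]
  by (cases "k \<ge> 0") auto

lemma sum_scaleR_int_mem:
  "finite B \<Longrightarrow> B \<subseteq> \<Lambda> \<Longrightarrow> (\<Sum>b\<in>B. real_of_int (k b) *\<^sub>R b) \<in> \<Lambda>"
  by (induction B rule: finite_induct) (auto simp: zero_mem intro: add_mem scaleR_int_mem)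

text \<open>The origin alone fills the ball. This supplies the positivity of the constants below,
  since \<open>A\<close> carries no sign assumption.\<close>

lemma card_ball_ge_1: "0 \<le> r \<Longrightarrow> 1 \<le> A * (1 + r) ^ D"
proof -
  assume r: "0 \<le> r"
  have "card {x \<in> \<Lambda>. norm x \<le> r} \<noteq> 0"
    using zero_mem r by (subst card_0_eq[OF finite_ball]) auto
  then show ?thesis using card_ball[OF r] by linarith
qed

text \<open>Pigeonhole: if a combination \<open>y\<close> with a coefficient of modulus at least 1 were very short,
  then rounding the coefficients of \<open>0, y, 2 y, \<dots>\<close> would produce too many distinct lattice
  points in a fixed ball.\<close>

lemma norm_sum_scaleR_ge:
  assumes B: "finite B" "B \<subseteq> \<Lambda>" "independent B" "\<And>b. b \<in> B \<Longrightarrow> norm b \<le> R"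
    and b: "b \<in> B" "\<bar>c b\<bar> \<ge> 1"
  shows "1 \<le> A * (2 + real (card B) * R) ^ D * norm (\<Sum>b\<in>B. c b *\<^sub>R b)"
proof (rule ccontr)
  define y where "y = (\<Sum>b\<in>B. c b *\<^sub>R b)"
  \<comment> \<open>Radius 1 holds the multiples of \<open>y\<close> that are used;
    \<open>card B * R\<close> is the largest possible rounding error.\<close>
  define r where "r = 1 + real (card B) * R"
  define P where "P = A * (1 + r) ^ D"
  have R: "R \<ge> 0" using B(4)[OF b(1)] norm_ge_zero by (rule order_trans[rotated])
  have r: "r \<ge> 0" using R by (simp add: r_def)
  have P: "P \<ge> 1" using card_ball_ge_1[OF r] by (simp add: P_def)
  assume "\<not> ?thesis"
  then have small: "P * norm y < 1" by (simp add: P_def r_def y_def add.commute)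
  \<comment> \<open>The indices \<open>0..N\<close> number more than \<open>P\<close>, yet
    \<open>n \<le> N \<le> P\<close> still keeps \<open>n * norm y\<close> below 1.\<close>
  define N where "N = nat \<lfloor>P\<rfloor>"
  have N: "real N \<le> P" "P < real N + 1" using P by (auto simp: N_def)
  define w where "w n = (\<Sum>b\<in>B. real_of_int \<lfloor>real n * c b\<rfloor> *\<^sub>R b)" for n :: nat
  have "inj_on w {..N}"
  proof (rule inj_onI)
    fix n n' :: nat
    assume "w n = w n'"
    then have "(\<Sum>b\<in>B. (real_of_int \<lfloor>real n * c b\<rfloor> - real_of_int \<lfloor>real n' * c b\<rfloor>) *\<^sub>R b) = 0"
      by (simp add: w_def scaleR_left_diff_distrib sum_subtractf)
    from independentD[OF B(3) B(1) order_refl this b(1)]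
    have fl: "\<lfloor>real n * c b\<rfloor> = \<lfloor>real n' * c b\<rfloor>" by simp
    \<comment> \<open>Two reals with the same floor differ by less than 1, whereas
      \<open>\<bar>c b\<bar> \<ge> 1\<close> separates the multiples for distinct
      \<open>n\<close>.\<close>
    have lt: "\<bar>(real n - real n') * c b\<bar> < 1"
      unfolding left_diff_distrib using fl by linarith
    show "n = n'"
    proof (rule ccontr)
      assume "n \<noteq> n'"
      then have "1 \<le> \<bar>real n - real n'\<bar>" by linarith
      then have "1 * 1 \<le> \<bar>real n - real n'\<bar> * \<bar>c b\<bar>" using b(2) by (intro mult_mono) auto
      with lt show False by (simp add: abs_mult)
    qed
  qed
  moreover have "w ` {..N} \<subseteq> {x \<in> \<Lambda>. norm x \<le> r}"
  proof safe
    fix n assume n: "n \<le> N"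
    show "w n \<in> \<Lambda>" unfolding w_def using B by (intro sum_scaleR_int_mem)
    have "real n *\<^sub>R y - w n = (\<Sum>b\<in>B. frac (real n * c b) *\<^sub>R b)"
      by (simp add: w_def y_def frac_def scaleR_sum_right scaleR_left_diff_distrib sum_subtractf)
    also have "norm \<dots> \<le> (\<Sum>b\<in>B. R)"
    proof (rule sum_norm_le)
      fix b assume "b \<in> B"
      have "norm (frac (real n * c b) *\<^sub>R b) \<le> 1 * norm b"
        unfolding norm_scaleR using frac_lt_1[of "real n * c b"]
        by (intro mult_right_mono) auto
      also have "\<dots> \<le> R" using B(4)[OF \<open>b \<in> B\<close>] by simp
      finally show "norm (frac (real n * c b) *\<^sub>R b) \<le> R" .
    qed
    finally have 1: "norm (real n *\<^sub>R y - w n) \<le> real (card B) * R" by simp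
    have "real n * norm y \<le> P * norm y" using n N by (intro mult_right_mono) auto
    with small have "norm (real n *\<^sub>R y) \<le> 1" by simp
    with 1 norm_triangle_ineq4[of "real n *\<^sub>R y" "real n *\<^sub>R y - w n"]
    show "norm (w n) \<le> r" by (simp add: r_def)
  qed
  ultimately have "card {..N} \<le> card {x \<in> \<Lambda>. norm x \<le> r}"
    using finite_ball by (rule card_inj_on_le)
  then have "real N + 1 \<le> P" using card_ball[OF r] by (simp add: P_def)
  with N show False by simp
qed

text \<open>By homogeneity: dividing the combination by \<open>c b\<close> makes that coefficient 1,
  and the preceding lower bound applies.\<close>

lemma abs_coeff_le:
  assumes B: "finite B" "B \<subseteq> \<Lambda>" "independent B" "\<And>b. b \<in> B \<Longrightarrow> norm b \<le> R"
    and b: "b \<in> B"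
  shows "\<bar>c b\<bar> \<le> A * (2 + real (card B) * R) ^ D * norm (\<Sum>b\<in>B. c b *\<^sub>R b)"
proof (cases "c b = 0")
  case True
  have "R \<ge> 0" using B(4)[OF b(1)] norm_ge_zero by (rule order_trans[rotated])
  with card_ball_ge_1[of "1 + real (card B) * R"] show ?thesis using True by (simp add: add.assoc[symmetric])
next
  case False
  have "(\<Sum>b'\<in>B. (c b' / c b) *\<^sub>R b') = (1 / c b) *\<^sub>R (\<Sum>b\<in>B. c b *\<^sub>R b)"
    by (simp add: scaleR_sum_right)
  with norm_sum_scaleR_ge[OF B b, of "\<lambda>b'. c b' / c b"] False
  show ?thesis by (simp add: field_simps)
qed

text \<open>Expand \<open>norm x\<close> squared as the sum of \<open>c b * (x \<bullet> b)\<close>.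
  The coefficients are at most a constant times \<open>norm x\<close>, so one factor
  \<open>norm x\<close> cancels. This replaces a lower bound on the Gram determinant of
  \<open>B\<close>.\<close>

lemma norm_le_of_inner_le:
  assumes B: "finite B" "B \<subseteq> \<Lambda>" "independent B" "\<And>b. b \<in> B \<Longrightarrow> norm b \<le> R"
    and x: "x \<in> span B" "\<And>b. b \<in> B \<Longrightarrow> \<bar>x \<bullet> b\<bar> \<le> M"
  shows "norm x \<le> real (card B) * (A * (2 + real (card B) * R) ^ D) * M"
proof (cases "x = 0 \<or> B = {}")
  case True
  moreover have "x = 0" if "B = {}" using that x(1) by simp
  moreover have "0 \<le> real (card B) * (A * (2 + real (card B) * R) ^ D) * M" if "B \<noteq> {}"
  proof -
    from that obtain b where b: "b \<in> B" by blast
    have "R \<ge> 0" "M \<ge> 0" using B(4)[OF b] x(2)[OF b] norm_ge_zero[of b] by linarith+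
    with card_ball_ge_1[of "1 + real (card B) * R"] show ?thesis by (simp add: add.assoc[symmetric])
  qed
  ultimately show ?thesis by (cases "B = {}") auto
next
  case False
  define P where "P = A * (2 + real (card B) * R) ^ D"
  obtain c where c: "x = (\<Sum>b\<in>B. c b *\<^sub>R b)"
    using x(1) span_finite[OF B(1)] by auto
  have "norm x * norm x = x \<bullet> (\<Sum>b\<in>B. c b *\<^sub>R b)"
    by (metis c dot_square_norm power2_eq_square)
  also have "\<dots> = (\<Sum>b\<in>B. c b * (x \<bullet> b))" by (simp add: inner_sum_right)
  also have "\<dots> \<le> (\<Sum>b\<in>B. P * norm x * M)"
  proof (rule sum_mono)
    fix b assume b: "b \<in> B"
    have "c b * (x \<bullet> b) \<le> \<bar>c b\<bar> * \<bar>x \<bullet> b\<bar>" by (metis abs_ge_self abs_mult)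
    also have "\<dots> \<le> P * norm x * M"
      using abs_coeff_le[OF B b, of c] x(2)[OF b] abs_ge_zero[of "c b"]
      by (intro mult_mono) (auto simp: P_def c simp del: abs_ge_zero intro: order_trans)
    finally show "c b * (x \<bullet> b) \<le> P * norm x * M" .
  qed
  also have "\<dots> = (real (card B) * P * M) * norm x" by simp
  finally show ?thesis using False by (simp add: P_def)
qed

end

section \<open>Slowly varying chains\<close>

lemma card_window_le:
  assumes "a + J \<le> L"
  shows "card {q. q \<le> J \<and> u (a + q) = x} \<le> card {q. q \<le> (L::nat) \<and> u q = x}"
  using assms by (intro card_inj_on_le[of "\<lambda>q. a + q"]) (auto simp: inj_on_def)

text \<open>This is what remains of a chain of sites after projection to \<open>W j\<close>.
  Distinct sites may share \<open>j\<close>, so injectivity weakens to multiplicity at most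
  \<open>K\<close>. A single \<open>H\<close> bounds the steps and the changes of squared
  norm.\<close>

definition slow_chain :: "'a::real_normed_vector set \<Rightarrow> real \<Rightarrow> real \<Rightarrow> nat \<Rightarrow> (nat \<Rightarrow> 'a) \<Rightarrow> bool" where
  "slow_chain \<Lambda> K H L u \<longleftrightarrow> (\<forall>q\<le>L. u q \<in> \<Lambda>) \<and> (\<forall>q<L. norm (u (Suc q) - u q) \<le> H) \<and>
     (\<forall>q<L. \<bar>(norm (u (Suc q)))\<^sup>2 - (norm (u q))\<^sup>2\<bar> \<le> H) \<and>
     (\<forall>x. real (card {q. q \<le> L \<and> u q = x}) \<le> K)"

lemma slow_chain_window:
  assumes "slow_chain \<Lambda> K H L u" "a + J \<le> L"
  shows "slow_chain \<Lambda> K H J (\<lambda>q. u (a + q))"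
proof -
  have "real (card {q. q \<le> J \<and> u (a + q) = x}) \<le> K" for x
    using assms(1) card_window_le[OF assms(2), of u x]
    unfolding slow_chain_def by (meson of_nat_mono order_trans)
  then show ?thesis using assms by (simp add: slow_chain_def)
qed

section \<open>Length bound by induction on the dimension\<close>

context polynomial_growth_lattice
begin

text \<open>The case where every window of length \<open>J\<close> spans the same \<open>G\<close>.
  The projection of each \<open>u q\<close> to \<open>G\<close> is then short and the component
  orthogonal to \<open>G\<close> is constant, so the chain stays in a ball where points can be
  counted.\<close>

lemma slow_chain_length_step:
  assumes X: "X \<ge> 2" "K \<le> X" "H \<le> X" "K \<ge> 1" "H \<ge> 0"
    and a: "A \<le> X ^ a" and J: "real J \<le> X ^ (C + 1)"
    and chain: "slow_chain \<Lambda> K H L u"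
    and dim: "dim G \<le> g" "subspace G" "\<And>q. q \<le> L \<Longrightarrow> u q - u 0 \<in> G"
    and window: "\<And>q0. q0 + J \<le> L \<Longrightarrow> span ((\<lambda>q. u (q0 + q) - u q0) ` {..J}) = G"
  shows "real L \<le> X ^ (C + 1 + (1 + a + (g + (a + (g + C + 3) * D) + (C + 2) * 2 + 2) * D) + 1)"
proof -
  have u: "\<And>q. q \<le> L \<Longrightarrow> u q \<in> \<Lambda>"
    and step: "\<And>q. q < L \<Longrightarrow> norm (u (Suc q) - u q) \<le> H"
    and step2: "\<And>q. q < L \<Longrightarrow> \<bar>(norm (u (Suc q)))\<^sup>2 - (norm (u q))\<^sup>2\<bar> \<le> H"
    and mult: "\<And>x. real (card {q. q \<le> L \<and> u q = x}) \<le> K"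
    using chain by (auto simp: slow_chain_def)
  \<comment> \<open>\<open>X ^ e\<close> will bound the projections: the summands account for
    \<open>card B\<close>, for the coefficient constant \<open>P\<close>, and for the inner
    products. In \<open>f\<close>, the 1 is the multiplicity \<open>K\<close> and the rest counts
    lattice points in a ball of radius \<open>2 * X ^ e\<close>.\<close>
  define e where "e = g + (a + (g + C + 3) * D) + (C + 2) * 2"
  define f where "f = 1 + a + (e + 2) * D"
  have pow_mono: "X ^ i \<le> X ^ j" if "i \<le> j" for i j using that X by (intro power_increasing) auto
  have pow_ge: "1 \<le> X ^ i" for i using X by simp
  have dbl: "2 * X ^ i \<le> X ^ Suc i" for i using X by simp
  have JH: "real J * H \<le> X ^ (C + 2)"
  proof -
    have "real J * H \<le> X ^ (C + 1) * X" using J X by (intro mult_mono) auto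
    then show ?thesis by (simp add: mult_ac)
  qed
  have JH0: "real J * H \<ge> 0" using X by simp
  \<comment> \<open>\<open>x\<close> is the orthogonal projection of \<open>u q0\<close> to
    \<open>G\<close>. It is bounded by testing against a basis of \<open>G\<close> taken from the
    window at \<open>q0\<close>, which consists of short lattice vectors.\<close>
  have "\<exists>x. x \<in> G \<and> norm x \<le> X ^ e \<and> (\<forall>w\<in>G. orthogonal (u q0 - x) w)" if q0: "q0 + J \<le> L" for q0
  proof -
    define S where "S = (\<lambda>q. u (q0 + q) - u q0) ` {..J}"
    have spanS: "span S = G" using window[OF q0] by (simp add: S_def)
    obtain B where B: "B \<subseteq> S" "independent B" "S \<subseteq> span B" "card B = dim S"
      by (rule basis_exists)
    have spanB: "span B = G" using B spanS by (metis span_mono span_span subset_antisym)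
    have cardB: "card B \<le> g" using B dim(1) spanS by (metis dim_span)
    have finB: "finite B" using B(1) by (rule finite_subset) (simp add: S_def)
    have BL: "B \<subseteq> \<Lambda>" using B(1) q0 u by (auto simp: S_def intro!: diff_mem)
    obtain x z where x: "x \<in> span S" "\<And>w. w \<in> span S \<Longrightarrow> orthogonal z w" "u q0 = x + z"
      using orthogonal_subspace_decomp_exists by blast
    have bnd: "norm b \<le> real J * H \<and> \<bar>x \<bullet> b\<bar> \<le> (X ^ (C + 2))\<^sup>2" if b: "b \<in> B" for b
    proof -
      from b B(1) obtain q where q: "q \<le> J" "b = u (q0 + q) - u q0" by (auto simp: S_def)
      have qJ: "H * real q \<le> real J * H" using q X by (simp add: mult.commute mult_left_mono)
      have nb: "norm b \<le> real J * H"
        using norm_diff_le_steps[of L u H q0 q, OF step] q q0 qJ by simp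
      have n2: "\<bar>(norm (u (q0 + q)))\<^sup>2 - (norm (u q0))\<^sup>2\<bar> \<le> real J * H"
        using norm_diff_le_steps[of L "\<lambda>q. (norm (u q))\<^sup>2" H q0 q] step2 q q0 qJ by simp
      \<comment> \<open>Polarization: \<open>x \<bullet> b\<close> equals
        \<open>u q0 \<bullet> b\<close>, which is determined by a difference of squared norms along
        the chain and by \<open>norm b\<close>, both controlled over a window.\<close>
      have "z \<bullet> b = 0" using x(2)[of b] b B(1) by (auto simp: orthogonal_def span_base)
      then have "2 * (x \<bullet> b) = 2 * (u q0 \<bullet> b)" by (simp add: x(3) inner_add_left)
      also have "\<dots> = (norm (u (q0 + q)))\<^sup>2 - (norm (u q0))\<^sup>2 - (norm b)\<^sup>2"
        unfolding q power2_norm_eq_inner by (simp add: inner_diff_left inner_diff_right inner_commute)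
      finally have "2 * \<bar>x \<bullet> b\<bar> \<le> real J * H + (norm b)\<^sup>2"
        using n2 zero_le_power2[of "norm b"] by linarith
      also have "\<dots> \<le> X ^ (C + 2) + (X ^ (C + 2))\<^sup>2"
        using JH nb by (intro add_mono power_mono) auto
      also have "\<dots> \<le> 2 * (X ^ (C + 2))\<^sup>2"
        using self_le_power[OF pow_ge[of "C + 2"], of 2] by linarith
      finally show ?thesis using nb by simp
    qed
    define P where "P = A * (2 + real (card B) * (real J * H)) ^ D"
    have "norm x \<le> real (card B) * P * (X ^ (C + 2))\<^sup>2"
      unfolding P_def using x(1) spanS spanB bnd by (intro norm_le_of_inner_le finB BL B(2)) auto
    moreover have "real (card B) \<le> X ^ g"
    proof -
      have "real (card B) \<le> 2 ^ card B" by (simp add: less_imp_le of_nat_less_two_power)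
      also have "\<dots> \<le> X ^ card B" using X by (intro power_mono) auto
      finally show ?thesis using pow_mono[OF cardB] by linarith
    qed
    moreover have "P \<le> X ^ (a + (g + C + 3) * D)"
    proof -
      have "2 \<le> X ^ (g + C + 2)"
        using order_trans[OF X(1)] pow_mono[of 1 "g + C + 2"] by simp
      moreover have "real (card B) * (real J * H) \<le> X ^ g * X ^ (C + 2)"
        using X \<open>real (card B) \<le> X ^ g\<close> JH JH0 by (intro mult_mono) auto
      moreover have "X ^ g * X ^ (C + 2) = X ^ (g + C + 2)"
        by (simp only: power_add[symmetric] add.assoc)
      moreover have "2 * X ^ (g + C + 2) \<le> X ^ (g + C + 3)"
        using dbl[of "g + C + 2"] by (simp only: add_Suc_right[symmetric] eval_nat_numeral)
      ultimately have le: "2 + real (card B) * (real J * H) \<le> X ^ (g + C + 3)" by linarith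
      have "P \<le> X ^ a * (X ^ (g + C + 3)) ^ D"
        unfolding P_def using a le JH0 X by (intro mult_mono power_mono) auto
      then show ?thesis by (simp add: power_add power_mult)
    qed
    moreover have "0 \<le> P" using card_ball_ge_1[of "1 + real (card B) * (real J * H)"] JH0
      by (simp add: P_def add.assoc[symmetric])
    ultimately have "norm x \<le> X ^ g * X ^ (a + (g + C + 3) * D) * (X ^ (C + 2))\<^sup>2"
      using X by (elim order_trans) (intro mult_mono; simp)
    also have "\<dots> = X ^ e"
      by (simp only: e_def power_add power_mult)
    finally have "norm x \<le> X ^ e" .
    then show ?thesis using x spanS by (intro exI[of _ x]) auto
  qed
  then obtain x where x: "\<And>q0. q0 + J \<le> L \<Longrightarrow>
      x q0 \<in> G \<and> norm (x q0) \<le> X ^ e \<and> (\<forall>w\<in>G. orthogonal (u q0 - x q0) w)"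
    by metis
  show ?thesis
  proof (cases "J \<le> L")
    case False
    then have "real L \<le> X ^ (C + 1)" using J by linarith
    also have "\<dots> \<le> X ^ (C + 1 + f + 1)" by (intro pow_mono) simp
    finally show ?thesis by (simp add: f_def e_def)
  next
    case True
    \<comment> \<open>\<open>q \<le> L - J\<close> leaves room for a window starting at
      \<open>q\<close>. The difference \<open>w\<close> of the orthogonal components lies in
      \<open>G\<close> and is orthogonal to \<open>G\<close>, so it vanishes.\<close>
    have ball: "norm (u q - u 0) \<le> 2 * X ^ e" if q: "q \<le> L - J" for q
    proof -
      have x0: "x q \<in> G" "norm (x q) \<le> X ^ e" "\<forall>w\<in>G. orthogonal (u q - x q) w"
        "x 0 \<in> G" "norm (x 0) \<le> X ^ e" "\<forall>w\<in>G. orthogonal (u 0 - x 0) w"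
        using x[of q] x[of 0] q True by auto
      define w where "w = (u q - u 0) - (x q - x 0)"
      have "w \<in> G"
        unfolding w_def using q
        by (intro subspace_diff[OF dim(2) dim(3) subspace_diff[OF dim(2) x0(1) x0(4)]]) simp
      moreover have "w = (u q - x q) - (u 0 - x 0)" by (simp add: w_def)
      ultimately have "w \<bullet> w = 0"
        using x0(3,6) unfolding orthogonal_def by (metis inner_diff_left diff_self)
      then have "u q - u 0 = x q - x 0" by (simp add: w_def)
      then show ?thesis using norm_triangle_ineq4[of "x q" "x 0"] x0 by simp
    qed
    define F where "F = {y \<in> \<Lambda>. norm y \<le> 2 * X ^ e}"
    have "real (card F) \<le> A * (1 + 2 * X ^ e) ^ D"
      unfolding F_def using X by (intro card_ball) auto
    also have "\<dots> \<le> X ^ a * (X ^ (e + 2)) ^ D"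
    proof (intro mult_mono power_mono)
      show "1 + 2 * X ^ e \<le> X ^ (e + 2)"
        using pow_ge[of e] dbl[of e] dbl[of "Suc e"]
        by (simp only: add_Suc_right add_0_right numeral_2_eq_2)
    qed (use a X in auto)
    finally have F: "real (card F) \<le> X ^ (a + (e + 2) * D)" by (simp only: power_add power_mult)
    have "real (card {..L - J}) \<le> K * real (card F)"
    proof (rule real_card_le_by_fibers)
      show "(\<lambda>q. u q - u 0) ` {..L - J} \<subseteq> F" using ball u by (auto simp: F_def intro!: diff_mem)
      show "finite F" unfolding F_def by (rule finite_ball)
      fix y
      have "card {i \<in> {..L - J}. u i - u 0 = y} \<le> card {q. q \<le> L \<and> u q = y + u 0}"
        by (intro card_mono) auto
      with mult[of "y + u 0"] show "real (card {i \<in> {..L - J}. u i - u 0 = y}) \<le> K" by linarith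
    qed (use X in auto)
    also have "\<dots> \<le> X * X ^ (a + (e + 2) * D)" using F X by (intro mult_mono) auto
    finally have "real (card {..L - J}) \<le> X ^ f" by (simp add: f_def)
    \<comment> \<open>The last \<open>J\<close> indices, at which no full window starts, are added
      back.\<close>
    then have "real L \<le> X ^ (C + 1) + X ^ f" using J True by (simp add: of_nat_diff)
    also have "\<dots> \<le> X ^ (C + 1 + f) + X ^ (C + 1 + f)" by (intro add_mono pow_mono) (auto simp: f_def)
    also have "\<dots> \<le> X ^ (C + 1 + f + 1)" using dbl[of "C + 1 + f"] by simp
    finally show ?thesis by (simp add: f_def e_def)
  qed
qed

text \<open>The exponent is quantified before \<open>X\<close>, \<open>K\<close>, \<open>H\<close>
  and the chain; it depends only on the lattice and on \<open>g\<close>.\<close>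

lemma slow_chain_length_le_of_dim:
  "\<exists>C. \<forall>X K H L u. 2 \<le> X \<longrightarrow> 1 \<le> K \<longrightarrow> K \<le> X \<longrightarrow> 0 \<le> H \<longrightarrow> H \<le> X \<longrightarrow>
     slow_chain \<Lambda> K H L u \<longrightarrow> dim ((\<lambda>q. u q - u 0) ` {..L}) \<le> g \<longrightarrow> real L \<le> X ^ C"
proof (induction g)
  case 0
  show ?case
  proof (intro exI[of _ 1] allI impI)
    fix X K H :: real and L and u :: "nat \<Rightarrow> 'a"
    assume K: "K \<le> X" and chain: "slow_chain \<Lambda> K H L u"
      and "dim ((\<lambda>q. u q - u 0) ` {..L}) \<le> 0"
    \<comment> \<open>In dimension 0 the chain stands still, so all \<open>L + 1\<close> indices lie
      in one fibre of size at most \<open>K\<close>.\<close>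
    then have "u q - u 0 = 0" if "q \<le> L" for q
      using that unfolding le_zero_eq dim_eq_0 by blast
    then have "{q. q \<le> L \<and> u q = u 0} = {..L}"
      unfolding right_minus_eq by blast
    moreover have "real (card {q. q \<le> L \<and> u q = u 0}) \<le> K"
      using chain by (simp add: slow_chain_def)
    ultimately show "real L \<le> X ^ 1" using K by simp
  qed
next
  case (Suc g)
  then obtain C where IH: "\<forall>X K H L u. 2 \<le> X \<longrightarrow> 1 \<le> K \<longrightarrow> K \<le> X \<longrightarrow> 0 \<le> H \<longrightarrow> H \<le> X \<longrightarrow>
     slow_chain \<Lambda> K H L u \<longrightarrow> dim ((\<lambda>q. u q - u 0) ` {..L}) \<le> g \<longrightarrow> real L \<le> X ^ C" ..
  \<comment> \<open>A power of 2 gives \<open>A \<le> X ^ a\<close> for every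
    \<open>X \<ge> 2\<close> with the same \<open>a\<close>.\<close>
  obtain a :: nat where a: "A \<le> 2 ^ a"
    using real_arch_pow[of 2 A] by (auto intro: less_imp_le)
  show ?case
  proof (intro exI[of _ "C + 1 + (1 + a + (Suc g + (a + (Suc g + C + 3) * D) + (C + 2) * 2 + 2) * D) + 1"] allI impI)
    fix X K H :: real and L and u :: "nat \<Rightarrow> 'a"
    assume X: "2 \<le> X" "1 \<le> K" "K \<le> X" "0 \<le> H" "H \<le> X"
      and chain: "slow_chain \<Lambda> K H L u"
      and dim: "dim ((\<lambda>q. u q - u 0) ` {..L}) \<le> Suc g"
    \<comment> \<open>Just longer than the induction hypothesis allows in dimension
      \<open>g\<close>: every window of length \<open>J\<close> must therefore have dimension
      \<open>g + 1\<close> and span all of \<open>G\<close>.\<close>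
    define J where "J = nat \<lfloor>X ^ C\<rfloor> + 1"
    define G where "G = span ((\<lambda>q. u q - u 0) ` {..L})"
    have XC: "1 \<le> X ^ C" using X by simp
    have J: "X ^ C < real J" "real J \<le> X ^ C + 1" using XC unfolding J_def by linarith+
    have "real J \<le> 2 * X ^ C" using J XC by simp
    also have "\<dots> \<le> X ^ (C + 1)" using X by simp
    finally have J': "real J \<le> X ^ (C + 1)" .
    have aX: "A \<le> X ^ a" using a power_mono[of 2 X a] X by linarith
    have inG: "u q - u 0 \<in> G" if "q \<le> L" for q
      unfolding G_def using that by (intro span_base) auto
    have "span ((\<lambda>q. u (q0 + q) - u q0) ` {..J}) = G" if q0: "q0 + J \<le> L" for q0
    proof -
      let ?S = "(\<lambda>q. u (q0 + q) - u q0) ` {..J}"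
      have sub: "?S \<subseteq> G"
      proof safe
        fix q assume "q \<le> J"
        then have "(u (q0 + q) - u 0) - (u q0 - u 0) \<in> G"
          using span_diff[OF inG[of "q0 + q", unfolded G_def] inG[of q0, unfolded G_def]] q0
          by (simp add: G_def)
        then show "u (q0 + q) - u q0 \<in> G" by simp
      qed
      have "\<not> dim ?S \<le> g"
      proof
        assume "dim ?S \<le> g"
        then have "real J \<le> X ^ C"
          by (intro IH[rule_format, of X K H J "\<lambda>q. u (q0 + q)"] X slow_chain_window[OF chain q0]) simp
        with J show False by simp
      qed
      moreover have "dim G \<le> Suc g" using dim by (simp add: G_def)
      ultimately have "span ?S = span G" using sub by (intro dim_eq_span) auto
      then show ?thesis by (simp add: G_def)
    qed
    then show "real L \<le> X ^ (C + 1 + (1 + a + (Suc g + (a + (Suc g + C + 3) * D) + (C + 2) * 2 + 2) * D) + 1)"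
      by (intro slow_chain_length_step[of X K H a J C L u G] X aX J' chain inG)
        (use dim in \<open>auto simp: G_def\<close>)
  qed
qed

lemma slow_chain_length_le:
  obtains C where "\<And>X K H L u. 2 \<le> X \<Longrightarrow> 1 \<le> K \<Longrightarrow> K \<le> X \<Longrightarrow> 0 \<le> H \<Longrightarrow> H \<le> X \<Longrightarrow>
     slow_chain \<Lambda> K H L u \<Longrightarrow> real L \<le> X ^ C"
proof -
  from slow_chain_length_le_of_dim[of "DIM('a)"] obtain C where
    C: "\<forall>X K H L u. 2 \<le> X \<longrightarrow> 1 \<le> K \<longrightarrow> K \<le> X \<longrightarrow> 0 \<le> H \<longrightarrow> H \<le> X \<longrightarrow>
     slow_chain \<Lambda> K H L u \<longrightarrow> dim ((\<lambda>q. u q - u 0) ` {..L}) \<le> DIM('a) \<longrightarrow> real L \<le> X ^ C" ..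
  show thesis by (rule that) (rule C[rule_format, OF _ _ _ _ _ _ dim_subset_UNIV])
qed

end

section \<open>Integer vectors and the dual lattice\<close>

lemma real_vec_diff: "real_vec (x - y) = real_vec x - real_vec y"
  by (simp add: real_vec_def vec_eq_iff)

lemma inj_real_vec: "inj real_vec"
  by (auto simp: inj_def real_vec_def vec_eq_iff)

lemma abs_nth_le_max_norm: "\<bar>x $ i\<bar> \<le> max_norm x"
  unfolding max_norm_def by (intro Max_ge) auto

lemma norm_real_vec_le:
  fixes x :: "int ^ 'n::finite"
  shows "norm (real_vec x) \<le> real CARD('n) * real_of_int (max_norm x)"
proof -
  have "norm (real_vec x) \<le> (\<Sum>i\<in>UNIV. \<bar>real_vec x $ i\<bar>)" by (rule norm_le_l1_cart)
  also have "\<dots> \<le> (\<Sum>i\<in>(UNIV :: 'n set). real_of_int (max_norm x))"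
    using abs_nth_le_max_norm[of x]
    by (intro sum_mono) (simp add: real_vec_def of_int_abs[symmetric] del: of_int_abs)
  finally show ?thesis by simp
qed

lemma abs_inner_real_vec_le:
  fixes x :: "int ^ 'n::finite"
  assumes "(\<Sum>p\<in>UNIV. \<bar>\<omega> $ p\<bar>) \<le> 1"
  shows "\<bar>\<omega> \<bullet> real_vec x\<bar> \<le> real_of_int (max_norm x)"
proof -
  have nonneg: "0 \<le> max_norm x"
    using abs_nth_le_max_norm[of x undefined] by linarith
  have "\<bar>\<omega> \<bullet> real_vec x\<bar> \<le> (\<Sum>i\<in>UNIV. \<bar>\<omega> $ i * real_of_int (x $ i)\<bar>)"
    by (simp add: inner_vec_def real_vec_def sum_abs)
  also have "\<dots> \<le> (\<Sum>i\<in>UNIV. \<bar>\<omega> $ i\<bar> * real_of_int (max_norm x))"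
    using abs_nth_le_max_norm[of x]
    by (intro sum_mono) (simp add: abs_mult mult_left_mono of_int_abs[symmetric] del: of_int_abs)
  also have "\<dots> = (\<Sum>i\<in>UNIV. \<bar>\<omega> $ i\<bar>) * real_of_int (max_norm x)"
    by (simp add: sum_distrib_right)
  also have "\<dots> \<le> 1 * real_of_int (max_norm x)"
    using assms nonneg by (intro mult_right_mono) auto
  finally show ?thesis by simp
qed

text \<open>The columns are independent and, by injectivity of \<open>v\<close>, there are
  \<open>CARD('d)\<close> of them; so the generator matrix has full rank, and invertibility passes
  to its inverse and transpose.\<close>

lemma inj_dual_matrix:
  fixes v :: "'d::finite \<Rightarrow> real ^ 'd"
  assumes "inj v" and "independent (range v)"
  shows "inj ((*v) (dual_matrix v))"
proof -
  have "column k (generator_matrix v) = v k" for k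
    by (simp add: column_def generator_matrix_def vec_eq_iff)
  then have "columns (generator_matrix v) = range v" by (auto simp: columns_def)
  then have "rank (generator_matrix v) = CARD('d)"
    using assms by (simp add: column_rank_def dim_eq_card_independent card_image)
  then have "invertible (generator_matrix v)"
    by (simp add: full_rank_injective invertible_left_inverse matrix_left_invertible_injective)
  then have "\<exists>B. generator_matrix v ** B = mat 1 \<and> B ** generator_matrix v = mat 1"
    by (simp add: invertible_def)
  \<comment> \<open>\<open>matrix_inv\<close> is a choice among two-sided inverses, so existence
    yields its defining equations.\<close>
  then have "generator_matrix v ** matrix_inv (generator_matrix v) = mat 1 \<and>
      matrix_inv (generator_matrix v) ** generator_matrix v = mat 1"
    unfolding matrix_inv_def by (rule someI_ex)
  then have "invertible (matrix_inv (generator_matrix v))"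
    unfolding invertible_def by blast
  then show ?thesis
    unfolding dual_matrix_def by (intro inj_matrix_vector_mult transpose_invertible)
qed

lemma finite_card_int_box:
  fixes t :: real
  assumes "0 \<le> t"
  shows "finite {x :: int ^ 'd::finite. \<forall>i. \<bar>real_of_int (x $ i)\<bar> \<le> t}"
    and "real (card {x :: int ^ 'd::finite. \<forall>i. \<bar>real_of_int (x $ i)\<bar> \<le> t}) \<le> (2 * t + 1) ^ CARD('d)"
proof -
  let ?S = "{x :: int ^ 'd. \<forall>i. \<bar>real_of_int (x $ i)\<bar> \<le> t}"
  let ?P = "PiE (UNIV :: 'd set) (\<lambda>_. {- \<lfloor>t\<rfloor>..\<lfloor>t\<rfloor>})"
  have sub: "?S \<subseteq> vec_lambda ` ?P"
  proof
    fix x assume x: "x \<in> ?S"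
    have "x $ i \<in> {- \<lfloor>t\<rfloor>..\<lfloor>t\<rfloor>}" for i
    proof -
      have "\<bar>real_of_int (x $ i)\<bar> \<le> t" using x by simp
      then show ?thesis by (simp add: le_floor_iff) linarith
    qed
    then show "x \<in> vec_lambda ` ?P"
      by (intro image_eqI[of _ _ "vec_nth x"]) (auto simp: PiE_def)
  qed
  have fin: "finite ?P" by (intro finite_PiE) auto
  show "finite ?S" using sub fin by (meson finite_imageI finite_subset)
  have "card ?S \<le> card ?P"
    using card_mono[OF finite_imageI[OF fin] sub] card_image_le[OF fin, of vec_lambda] by linarith
  also have "card ?P = nat (2 * \<lfloor>t\<rfloor> + 1) ^ CARD('d)"
    by (simp add: card_PiE algebra_simps)
  finally have "real (card ?S) \<le> real (nat (2 * \<lfloor>t\<rfloor> + 1)) ^ CARD('d)"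
    by (metis of_nat_le_iff of_nat_power)
  also have "\<dots> \<le> (2 * t + 1) ^ CARD('d)"
    using assms of_int_floor_le[of t] by (intro power_mono) auto
  finally show "real (card ?S) \<le> (2 * t + 1) ^ CARD('d)" .
qed

text \<open>An injective linear map is bounded below by some \<open>b > 0\<close>, so a ball of
  radius \<open>r\<close> pulls back into the integer box of half-width
  \<open>r / b\<close>.\<close>

lemma polynomial_growth_lattice_image_real_vec:
  fixes W :: "real ^ 'd ^ 'e"
  assumes "inj ((*v) W)"
  obtains A where "polynomial_growth_lattice (range (\<lambda>j. W *v real_vec j)) A CARD('d)"
proof -
  obtain b where b: "b > 0" "\<And>x. b * norm x \<le> norm (W *v x)"
    using linear_inj_bounded_below_pos[OF matrix_vector_mul_linear assms] by blast
  let ?\<Lambda> = "range (\<lambda>j. W *v real_vec j)"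
  let ?S = "\<lambda>r. {j :: int ^ 'd. \<forall>i. \<bar>real_of_int (j $ i)\<bar> \<le> r / b}"
  have sub: "{x \<in> ?\<Lambda>. norm x \<le> r} \<subseteq> (\<lambda>j. W *v real_vec j) ` ?S r" for r
  proof clarify
    fix j :: "int ^ 'd" assume j: "norm (W *v real_vec j) \<le> r"
    have "\<bar>real_of_int (j $ i)\<bar> \<le> r / b" for i
    proof -
      have "b * \<bar>real_of_int (j $ i)\<bar> \<le> b * norm (real_vec j)"
        using component_le_norm_cart[of "real_vec j" i] b(1) by (simp add: real_vec_def)
      also have "\<dots> \<le> r" using b(2) j by (rule order_trans)
      finally show ?thesis using b(1) by (simp add: field_simps)
    qed
    then show "W *v real_vec j \<in> (\<lambda>j. W *v real_vec j) ` ?S r" by blast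
  qed
  show thesis
  \<comment> \<open>The constant comes from
    \<open>2 * (r / b) + 1 \<le> (1 + 2 / b) * (1 + r)\<close>.\<close>
  proof (rule that[of "(1 + 2 / b) ^ CARD('d)"], unfold_locales)
    show "0 \<in> ?\<Lambda>" by (rule range_eqI[of _ _ 0]) (simp add: real_vec_def vec_eq_iff zero_vec_def[symmetric])
    show "x - y \<in> ?\<Lambda>" if "x \<in> ?\<Lambda>" "y \<in> ?\<Lambda>" for x y
      using that by (auto simp: matrix_vector_mult_diff_distrib[symmetric] real_vec_diff[symmetric])
    show fin: "finite {x \<in> ?\<Lambda>. norm x \<le> r}" for r
    proof (cases "r \<ge> 0")
      case True
      then show ?thesis using b(1) finite_card_int_box(1)[of "r / b"]
        by (intro finite_subset[OF sub] finite_imageI) simp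
    next
      case False
      then have "{x \<in> ?\<Lambda>. norm x \<le> r} = {}" using norm_ge_zero order_trans by blast
      then show ?thesis by (simp only: finite.emptyI)
    qed
    fix r :: real assume r: "0 \<le> r"
    have finS: "finite (?S r)" using r b(1) by (intro finite_card_int_box(1)) simp
    have "card {x \<in> ?\<Lambda>. norm x \<le> r} \<le> card (?S r)"
      using card_mono[OF finite_imageI[OF finS] sub] card_image_le[OF finS] by (rule order_trans)
    then have "real (card {x \<in> ?\<Lambda>. norm x \<le> r}) \<le> real (card (?S r))" by simp
    also have "\<dots> \<le> (2 * (r / b) + 1) ^ CARD('d)"
      using r b(1) by (intro finite_card_int_box(2)) simp
    also have "\<dots> \<le> ((1 + 2 / b) * (1 + r)) ^ CARD('d)"
      using r b(1) by (intro power_mono) (auto simp: field_simps)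
    finally show "real (card {x \<in> ?\<Lambda>. norm x \<le> r}) \<le> (1 + 2 / b) ^ CARD('d) * (1 + r) ^ CARD('d)"
      by (simp add: power_mult_distrib)
  qed
qed

section \<open>From singular sites to slow chains\<close>

text \<open>Cut the indices into consecutive blocks of \<open>N + 1\<close> and pick one hit in
  each; picks from adjacent blocks are less than two block lengths apart.\<close>

lemma subsequence_with_small_gaps:
  assumes hit: "\<And>q. q + N \<le> L \<Longrightarrow> \<exists>r\<in>{q..q + N}. P r" and "N \<le> L"
  obtains p M where "\<And>i. i \<le> M \<Longrightarrow> p i \<le> L" "\<And>i. i \<le> M \<Longrightarrow> P (p i)"
    "\<And>i. i < M \<Longrightarrow> p i < p (Suc i)" "\<And>i. i < M \<Longrightarrow> p (Suc i) \<le> p i + 2 * Suc N"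
    "L \<le> (M + 2) * Suc N"
proof -
  \<comment> \<open>\<open>M\<close> is the number, counted from 0, of the last block that fits
    entirely below \<open>L\<close>.\<close>
  define M where "M = (L - N) div Suc N"
  define t where "t = (L - N) mod Suc N"
  have "L = M * Suc N + t + N" "t \<le> N"
    using \<open>N \<le> L\<close> div_mult_mod_eq[of "L - N" "Suc N"] mod_less_divisor[OF zero_less_Suc, of "L - N" N]
    unfolding M_def t_def by linarith+
  then have M: "M * Suc N + N \<le> L" and M': "L \<le> (M + 2) * Suc N"
    by (simp_all add: add_mult_distrib)
  have "\<exists>r\<in>{i * Suc N..i * Suc N + N}. P r" if "i \<le> M" for i
    using mult_le_mono1[OF that, of "Suc N"] M by (intro hit) linarith
  then obtain p where p: "\<And>i. i \<le> M \<Longrightarrow> p i \<in> {i * Suc N..i * Suc N + N} \<and> P (p i)"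
    by metis
  show thesis
  proof (rule that[of M p])
    show "p i \<le> L" if "i \<le> M" for i
      using p[OF that] mult_le_mono1[OF that, of "Suc N"] M
      unfolding atLeastAtMost_iff by linarith
    show "P (p i)" if "i \<le> M" for i using p[OF that] by blast
    show "p i < p (Suc i)" "p (Suc i) \<le> p i + 2 * Suc N" if "i < M" for i
      using p[of i] p[of "Suc i"] that by auto
  qed (rule M')
qed

text \<open>Singularity pins the squared norm of \<open>W j\<close> to within 1 of the signed phase
  minus \<open>m\<close>. With one fixed sign, \<open>m\<close> and \<open>\<theta>\<close> cancel
  in differences, so the squared norm varies as slowly as the phase.\<close>

lemma slow_chain_of_same_sign_sites:
  fixes v :: "'d::finite \<Rightarrow> real ^ 'd" and s :: "nat \<Rightarrow> ('n::finite, 'd) site"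
  assumes inj: "inj ((*v) (dual_matrix v))"
    and B: "0 < B" "\<And>x. norm (dual_matrix v *v x) \<le> B * norm x"
    and \<omega>: "(\<Sum>p\<in>UNIV. \<bar>\<omega> $ p\<bar>) \<le> 1" and lam: "lam \<in> {1/2..3/2}" and \<Gamma>: "\<Gamma> \<ge> 2"
    and S: "S \<subseteq> singular_sites v m \<omega> lam \<theta>" "sections_bounded K S"
    and s: "is_chain \<Gamma> L s" "s ` {..L} \<subseteq> S"
    and p: "\<And>i. i \<le> M \<Longrightarrow> p i \<le> L" "\<And>i. i < M \<Longrightarrow> p i < p (Suc i)"
      "\<And>i. i < M \<Longrightarrow> p (Suc i) \<le> p i + g"
    and sign: "\<And>i. i \<le> M \<Longrightarrow> snd (snd (s (p i))) = \<sigma>" and g: "1 \<le> g"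
  shows "slow_chain (range (\<lambda>j. dual_matrix v *v real_vec j)) K
    ((B * real CARD('d) + 4) * (real g * \<Gamma>)) M
    (\<lambda>i. dual_matrix v *v real_vec (fst (snd (s (p i)))))"
proof -
  define w where "w q = dual_matrix v *v real_vec (fst (snd (s q)))" for q
  \<comment> \<open>Neither \<open>F\<close> nor \<open>w\<close> involves the sign, so both can be
    followed through the skipped sites between \<open>p i\<close> and \<open>p (Suc i)\<close>,
    whatever signs these have.\<close>
  define F where "F q = lam * (\<omega> \<bullet> real_vec (fst (s q))) + \<theta>" for q
  have g\<Gamma>: "2 \<le> real g * \<Gamma>" using mult_mono[of 1 "real g" 2 \<Gamma>] g \<Gamma> by simp
  have site: "real_of_int (max_norm (fst (s (Suc q)) - fst (s q))) \<le> \<Gamma>"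
    "real_of_int (max_norm (fst (snd (s (Suc q))) - fst (snd (s q)))) \<le> \<Gamma>" if "q < L" for q
  proof -
    have d: "real_of_int (site_dist (s q) (s (Suc q))) \<le> \<Gamma>"
      using s(1) that by (simp add: is_chain_def)
    have "max_norm (fst (s (Suc q)) - fst (s q)) \<le> site_dist (s q) (s (Suc q))"
      "max_norm (fst (snd (s (Suc q))) - fst (snd (s q))) \<le> site_dist (s q) (s (Suc q))"
      by (auto simp: site_dist_def split: prod.split)
    with d show "real_of_int (max_norm (fst (s (Suc q)) - fst (s q))) \<le> \<Gamma>"
      "real_of_int (max_norm (fst (snd (s (Suc q))) - fst (snd (s q)))) \<le> \<Gamma>" by linarith+
  qed
  have w_step: "norm (w (Suc q) - w q) \<le> B * real CARD('d) * \<Gamma>" if "q < L" for q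
  proof -
    let ?x = "fst (snd (s (Suc q))) - fst (snd (s q))"
    have "norm (w (Suc q) - w q) \<le> B * norm (real_vec ?x)"
      unfolding w_def matrix_vector_mult_diff_distrib[symmetric] real_vec_diff[symmetric] by (rule B(2))
    also have "norm (real_vec ?x) \<le> real CARD('d) * \<Gamma>"
      using norm_real_vec_le[of ?x] site(2)[OF that]
      by (meson mult_left_mono of_nat_0_le_iff order_trans)
    finally show ?thesis using B(1) by (simp add: mult_ac)
  qed
  have F_step: "\<bar>F (Suc q) - F q\<bar> \<le> 3 / 2 * \<Gamma>" if "q < L" for q
  proof -
    have "\<bar>F (Suc q) - F q\<bar> = \<bar>lam\<bar> * \<bar>\<omega> \<bullet> real_vec (fst (s (Suc q)) - fst (s q))\<bar>"
      by (simp add: F_def real_vec_diff inner_diff_right right_diff_distrib[symmetric] abs_mult[symmetric])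
    also have "\<dots> \<le> 3 / 2 * \<Gamma>"
      using lam site(1)[OF that] abs_inner_real_vec_le[OF \<omega>, of "fst (s (Suc q)) - fst (s q)"]
      by (intro mult_mono) auto
    finally show ?thesis .
  qed
  have sing: "\<bar>real_of_int \<sigma> * F (p i) - (norm (w (p i)))\<^sup>2 - m\<bar> < 1" "\<bar>real_of_int \<sigma>\<bar> = 1"
    if "i \<le> M" for i
  proof -
    have "s (p i) \<in> singular_sites v m \<omega> lam \<theta>" using S(1) s(2) p(1)[OF that] by blast
    then have "\<bar>D_entry v m \<omega> lam \<theta> (s (p i))\<bar> < 1" "s (p i) \<in> sites"
      by (auto simp: singular_sites_def)
    then show "\<bar>real_of_int \<sigma> * F (p i) - (norm (w (p i)))\<^sup>2 - m\<bar> < 1" "\<bar>real_of_int \<sigma>\<bar> = 1"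
      using sign[OF that] by (auto simp: D_entry_def sites_def F_def w_def \<mu>_def split: prod.splits)
  qed
  have gap: "\<exists>k. p (Suc i) = p i + k \<and> p i + k \<le> L \<and> real k \<le> real g" if "i < M" for i
    using p(1)[of "Suc i"] p(2,3)[OF that] that by (intro exI[of _ "p (Suc i) - p i"]) auto
  have "norm (w (p (Suc i)) - w (p i)) \<le> (B * real CARD('d) + 4) * (real g * \<Gamma>)" if i: "i < M" for i
  proof -
    obtain k where k: "p (Suc i) = p i + k" "p i + k \<le> L" "real k \<le> real g" using gap[OF i] by blast
    have "norm (w (p (Suc i)) - w (p i)) \<le> B * real CARD('d) * \<Gamma> * real k"
      using norm_diff_le_steps[of L w, OF w_step] k by simp
    also have "\<dots> \<le> B * real CARD('d) * \<Gamma> * real g"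
      using k(3) B(1) \<Gamma> by (intro mult_left_mono) auto
    also have "\<dots> \<le> (B * real CARD('d) + 4) * (real g * \<Gamma>)"
      using g\<Gamma> by (simp add: algebra_simps)
    finally show ?thesis .
  qed
  moreover have "\<bar>(norm (w (p (Suc i))))\<^sup>2 - (norm (w (p i)))\<^sup>2\<bar> \<le> (B * real CARD('d) + 4) * (real g * \<Gamma>)"
    if i: "i < M" for i
  proof -
    obtain k where k: "p (Suc i) = p i + k" "p i + k \<le> L" "real k \<le> real g" using gap[OF i] by blast
    have "\<bar>F (p (Suc i)) - F (p i)\<bar> \<le> 3 / 2 * \<Gamma> * real k"
      using norm_diff_le_steps[of L F, unfolded real_norm_def, OF F_step] k by simp
    also have "\<dots> \<le> 3 / 2 * \<Gamma> * real g" using k(3) \<Gamma> by (intro mult_left_mono) auto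
    finally have "\<bar>real_of_int \<sigma> * F (p (Suc i)) - real_of_int \<sigma> * F (p i)\<bar> \<le> 3 / 2 * (real g * \<Gamma>)"
      using sing(2)[of i] i by (simp add: right_diff_distrib[symmetric] abs_mult mult_ac)
    \<comment> \<open>The singularity condition costs less than 1 at each end; this total of 2 is
      absorbed by \<open>2 \<le> g * \<Gamma>\<close>.\<close>
    then have "\<bar>(norm (w (p (Suc i))))\<^sup>2 - (norm (w (p i)))\<^sup>2\<bar> \<le> 4 * (real g * \<Gamma>)"
      using sing(1)[of i] sing(1)[of "Suc i"] i g\<Gamma>
      unfolding abs_le_iff abs_less_iff Suc_le_eq by linarith
    also have "\<dots> \<le> (B * real CARD('d) + 4) * (real g * \<Gamma>)"
      using g\<Gamma> B(1) by (intro mult_right_mono) auto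
    finally show ?thesis .
  qed
  \<comment> \<open>By injectivity of the dual matrix, equal values of \<open>w\<close> mean equal
    \<open>j\<close>; the distinct sites involved lie in one section of \<open>S\<close>.\<close>
  moreover have "real (card {i. i \<le> M \<and> w (p i) = x}) \<le> K" for x
  proof (cases "\<exists>i\<le>M. w (p i) = x")
    case False
    then have "{i. i \<le> M \<and> w (p i) = x} = {}" by blast
    moreover have "0 \<le> K" using S(2) unfolding sections_bounded_def by (meson of_nat_0_le_iff order_trans)
    ultimately show ?thesis by (simp only: card.empty of_nat_0)
  next
    case True
    then obtain i0 where i0: "i0 \<le> M" "w (p i0) = x" by blast
    define j' where "j' = fst (snd (s (p i0)))"
    \<comment> \<open>\<open>p\<close> is known to increase only up to \<open>M\<close>, hence an
      induction with an explicit range.\<close>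
    have p_less: "i + Suc k \<le> M \<Longrightarrow> p i < p (i + Suc k)" for i k
    proof (induction k)
      case (Suc k)
      then show ?case using p(2)[of "i + Suc k"] by simp
    qed (use p(2) in simp)
    have "inj_on p {..M}"
    proof (rule linorder_inj_onI)
      fix i i' assume "i < i'" "i' \<in> {..M}"
      then show "p i \<noteq> p i'" using p_less[of i "i' - Suc i"] by simp
    qed auto
    have "card {i. i \<le> M \<and> w (p i) = x} \<le> card {(l, j, a) \<in> S. j = j'}"
    proof (rule card_inj_on_le)
      show "inj_on (\<lambda>i. s (p i)) {i. i \<le> M \<and> w (p i) = x}"
      proof (rule inj_onI)
        fix i i'
        assume "i \<in> {i. i \<le> M \<and> w (p i) = x}" "i' \<in> {i. i \<le> M \<and> w (p i) = x}" "s (p i) = s (p i')"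
        moreover have "inj_on s {..L}" using s(1) by (simp add: is_chain_def)
        ultimately show "i = i'" using p(1) \<open>inj_on p {..M}\<close> by (auto dest!: inj_onD)
      qed
      show "(\<lambda>i. s (p i)) ` {i. i \<le> M \<and> w (p i) = x} \<subseteq> {(l, j, a) \<in> S. j = j'}"
      proof (rule image_subsetI)
        fix i assume "i \<in> {i. i \<le> M \<and> w (p i) = x}"
        then have i: "i \<le> M" "x = w (p i)" by auto
        then have "fst (snd (s (p i))) = j'"
          using i0(2) inj inj_real_vec unfolding w_def j'_def by (auto dest: injD)
        moreover have "s (p i) \<in> S" using s(2) p(1)[OF i(1)] by blast
        ultimately show "s (p i) \<in> {(l, j, a) \<in> S. j = j'}" by (auto simp: case_prod_beta)
      qed
      show "finite {(l, j, a) \<in> S. j = j'}" using S(2) by (simp add: sections_bounded_def)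
    qed
    moreover have "real (card {(l, j, a) \<in> S. j = j'}) \<le> K" using S(2) by (simp add: sections_bounded_def)
    ultimately show ?thesis by linarith
  qed
  ultimately show ?thesis by (auto simp: slow_chain_def w_def)
qed

section \<open>Mixed signs and the final exponent\<close>

theorem proposition4p1:
  fixes v :: "'d::finite \<Rightarrow> real ^ 'd"
  assumes "inj v" and "independent (range v)"
  shows "\<exists>C::real. C > 0 \<and>
    (\<forall>(m::real) (\<omega> :: real ^ 'n::finite).
       (\<Sum>p\<in>UNIV. \<bar>\<omega> $ p\<bar>) \<le> 1 \<longrightarrow> diophantine \<omega> \<longrightarrow>
       (\<forall>lam\<in>{1/2..3/2::real}. \<forall>(\<theta>::real) (K::real) (\<Gamma>::real). K > 1 \<longrightarrow> \<Gamma> \<ge> 2 \<longrightarrow>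
          (\<forall>S L s. S \<subseteq> singular_sites v m \<omega> lam \<theta> \<longrightarrow> sections_bounded K S \<longrightarrow>
             is_chain \<Gamma> L s \<longrightarrow> s ` {..L} \<subseteq> S \<longrightarrow>
             real L \<le> (K * \<Gamma>) powr C)))"
proof -
  have inj: "inj ((*v) (dual_matrix v))" using assms by (rule inj_dual_matrix)
  let ?\<Lambda> = "range (\<lambda>j. dual_matrix v *v real_vec j)"
  obtain A where A: "polynomial_growth_lattice ?\<Lambda> A CARD('d)"
    using polynomial_growth_lattice_image_real_vec[OF inj] .
  obtain E where E: "\<And>X K H L u. 2 \<le> X \<Longrightarrow> 1 \<le> K \<Longrightarrow> K \<le> X \<Longrightarrow> 0 \<le> H \<Longrightarrow> H \<le> X \<Longrightarrow>
     slow_chain ?\<Lambda> K H L u \<Longrightarrow> real L \<le> X ^ E"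
    using polynomial_growth_lattice.slow_chain_length_le[OF A] by blast
  obtain B where B: "0 < B" "\<And>x. norm (dual_matrix v *v x) \<le> B * norm x"
    using linear_bounded_pos[OF matrix_vector_mul_linear] by blast
  define c where "c = B * real CARD('d) + 4"
  have c: "4 \<le> c" using B(1) by (simp add: c_def)
  \<comment> \<open>Since \<open>2 \<le> K * \<Gamma>\<close>, the factor \<open>c\<close> can be
    moved into the exponent. \<open>E\<close>, \<open>c\<close> and \<open>k\<close> are fixed
    before \<open>m\<close>, \<open>\<omega>\<close> and the chain are introduced.\<close>
  obtain k :: nat where k: "c \<le> 2 ^ k"
    using real_arch_pow[of 2 c] by (auto intro: less_imp_le)
  define T where "T = (E + 4) * E + 2 + (E + 2)"
  show ?thesis
  proof (intro exI[of _ "real ((k + 1) * T)"] conjI allI impI ballI)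
    show "0 < real ((k + 1) * T)" unfolding of_nat_0_less_iff by (simp add: T_def)
    fix m :: real and \<omega> :: "real ^ 'n" and lam \<theta> K \<Gamma> :: real and S L and s :: "nat \<Rightarrow> ('n, 'd) site"
    assume \<omega>: "(\<Sum>p\<in>UNIV. \<bar>\<omega> $ p\<bar>) \<le> 1" and lam: "lam \<in> {1/2..3/2}" and K: "K > 1"
      and \<Gamma>: "\<Gamma> \<ge> 2" and S: "S \<subseteq> singular_sites v m \<omega> lam \<theta>" "sections_bounded K S"
      and s: "is_chain \<Gamma> L s" "s ` {..L} \<subseteq> S"
    \<comment> \<open>Applied twice: with \<open>g = 1\<close> to runs of sign -1, and with a larger
      \<open>g\<close> to the subsequence of sites of sign 1.\<close>
    have bound: "real M \<le> (real g * (c * (K * \<Gamma>))) ^ E"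
      if "1 \<le> g" "\<And>i. i \<le> M \<Longrightarrow> p i \<le> L" "\<And>i. i < M \<Longrightarrow> p i < p (Suc i)"
        "\<And>i. i < M \<Longrightarrow> p (Suc i) \<le> p i + g" "\<And>i. i \<le> M \<Longrightarrow> snd (snd (s (p i))) = \<sigma>"
      for p M g \<sigma>
    proof (rule E)
      have g\<Gamma>: "8 \<le> real g * (c * \<Gamma>)"
        using mult_mono[of 4 c 2 \<Gamma>] mult_mono[of 1 "real g" 8 "c * \<Gamma>"] that(1) c \<Gamma> by simp
      have eq: "real g * (c * (K * \<Gamma>)) = K * (real g * (c * \<Gamma>))" by (simp add: mult_ac)
      show "1 \<le> K" using K by simp
      show "K \<le> real g * (c * (K * \<Gamma>))" "2 \<le> real g * (c * (K * \<Gamma>))"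
        unfolding eq using mult_left_mono[OF g\<Gamma>, of K] K by linarith+
      show "0 \<le> c * (real g * \<Gamma>)" using g\<Gamma> by (simp add: mult_ac)
      show "c * (real g * \<Gamma>) \<le> real g * (c * (K * \<Gamma>))"
        unfolding eq using mult_right_mono[of 1 K "real g * (c * \<Gamma>)"] K g\<Gamma> by (simp add: mult_ac)
      show "slow_chain ?\<Lambda> K (c * (real g * \<Gamma>)) M (\<lambda>i. dual_matrix v *v real_vec (fst (snd (s (p i)))))"
        unfolding c_def by (rule slow_chain_of_same_sign_sites
            [where p = p and s = s and \<sigma> = \<sigma> and M = M and g = g, OF inj B \<omega> lam \<Gamma> S s that(2-5,1)])
    qed
    define X where "X = c * (K * \<Gamma>)"
    have K\<Gamma>: "2 \<le> K * \<Gamma>" using mult_mono[of 1 K 2 \<Gamma>] K \<Gamma> by simp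
    have X: "8 \<le> X" using mult_mono[of 4 c 2 "K * \<Gamma>"] c K\<Gamma> by (simp add: X_def)
    have XK: "X \<le> (K * \<Gamma>) ^ (k + 1)"
    proof -
      have "c \<le> (K * \<Gamma>) ^ k" using k power_mono[OF K\<Gamma>, of k] by linarith
      then have "X \<le> (K * \<Gamma>) ^ k * (K * \<Gamma>)"
        unfolding X_def using K\<Gamma> by (intro mult_right_mono) auto
      then show ?thesis by (simp add: mult.commute)
    qed
    have XE: "1 \<le> X ^ E" using X by simp
    \<comment> \<open>\<open>N\<close> exceeds the bound for a same-sign run, so
      \<open>N + 1\<close> consecutive sites cannot all have sign -1.\<close>
    define N where "N = nat \<lfloor>X ^ E\<rfloor> + 1"
    have N: "X ^ E < real N" "real N \<le> X ^ E + 1" using XE unfolding N_def by linarith+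
    have "2 * real (Suc N) \<le> 6 * X ^ E" using N XE by simp
    also have "\<dots> \<le> X * X ^ E" using X by (intro mult_right_mono) auto
    finally have SN: "2 * real (Suc N) \<le> X ^ (E + 1)" by simp
    have "L \<le> X ^ T"
    proof (cases "N \<le> L")
      case False
      then have "real L \<le> 2 * real (Suc N)" by simp
      also have "\<dots> \<le> X ^ (E + 1)" by (rule SN)
      also have "\<dots> \<le> X ^ T" using X by (intro power_increasing) (auto simp: T_def)
      finally show ?thesis .
    next
      case True
      have hit: "\<exists>r\<in>{q..q + N}. snd (snd (s r)) = 1" if q: "q + N \<le> L" for q
      proof (rule ccontr)
        assume "\<not> ?thesis"
        then have "snd (snd (s (q + i))) \<noteq> 1" if "i \<le> N" for i using that by auto
        moreover have "snd (snd (s (q + i))) \<in> {1, -1}" if "i \<le> N" for i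
          using s(1) q that by (auto simp: is_chain_def sites_def image_subset_iff mem_Times_iff)
        ultimately have "snd (snd (s (q + i))) = - 1" if "i \<le> N" for i using that by blast
        then have "real N \<le> (real 1 * X) ^ E"
          unfolding X_def using q by (intro bound[of 1 N "\<lambda>i. q + i" "- 1"]) auto
        with N show False by simp
      qed
      show ?thesis
      proof (rule subsequence_with_small_gaps[of N L "\<lambda>r. snd (snd (s r)) = 1", OF hit True])
        fix p M
        assume p: "\<And>i. i \<le> M \<Longrightarrow> p i \<le> L" "\<And>i. i \<le> M \<Longrightarrow> snd (snd (s (p i))) = 1"
          "\<And>i. i < M \<Longrightarrow> p i < p (Suc i)" "\<And>i. i < M \<Longrightarrow> p (Suc i) \<le> p i + 2 * Suc N"
          and L: "L \<le> (M + 2) * Suc N"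
        \<comment> \<open>Skipping the sites of sign -1 enlarges the step to at most
          \<open>2 * Suc N\<close> indices, which is only a power of \<open>X\<close>.\<close>
        have "real M \<le> (real (2 * Suc N) * X) ^ E"
          unfolding X_def using p by (intro bound[of "2 * Suc N" M p 1]) auto
        also have "\<dots> \<le> (X ^ (E + 1) * X) ^ E"
          using SN X by (intro power_mono mult_right_mono) auto
        also have "X ^ (E + 1) * X = X ^ (E + 2)" by simp
        also have "(X ^ (E + 2)) ^ E \<le> X ^ ((E + 4) * E)"
          unfolding power_mult[symmetric] using X
            by (intro power_increasing mult_le_mono) auto
        finally have M: "real M \<le> X ^ ((E + 4) * E)" .
        have "1 \<le> X ^ ((E + 4) * E)" using X by (intro one_le_power) auto
        then have "real (M + 2) \<le> 3 * X ^ ((E + 4) * E)" using M by simp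
        also have "\<dots> \<le> X * X ^ ((E + 4) * E)" using X by (intro mult_right_mono) auto
        finally have M2: "real (M + 2) \<le> X ^ ((E + 4) * E + 1)" by simp
        \<comment> \<open>The number of blocks times the block length recovers the whole chain; both
          are powers of \<open>X\<close>.\<close>
        have "real L \<le> real (M + 2) * real (Suc N)" using L by (metis of_nat_le_iff of_nat_mult)
        also have "\<dots> \<le> X ^ ((E + 4) * E + 1) * X ^ (E + 1)"
          using M2 SN X by (intro mult_mono) auto
        also have "\<dots> = X ^ ((E + 4) * E + 1 + (E + 1))" by (rule power_add[symmetric])
        also have "\<dots> \<le> X ^ T" using X by (intro power_increasing) (auto simp: T_def)
        finally show ?thesis .
      qed
    qed
    also have "\<dots> \<le> ((K * \<Gamma>) ^ (k + 1)) ^ T" using X XK by (intro power_mono) auto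
    also have "\<dots> = (K * \<Gamma>) powr real ((k + 1) * T)"
      unfolding power_mult[symmetric] using K\<Gamma> by (intro powr_realpow[symmetric]) linarith
    finally show "real L \<le> (K * \<Gamma>) powr real ((k + 1) * T)" .
  qed
qed

end
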